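(* Suppose $M:=\sum_{t=0}^\infty\big(\sup_{i\in\mathcal S,u\in U}|f(t,i,u)|+\delta(t)\big)<\infty$ and let $\lambda>0$. For any $y\in\mathbb R^d$, $$y=V^\pi_\lambda\text{ for some regular relaxed equilibrium }\pi\in\Pi_r\text{ for }J_\lambda\iff\Psi_\lambda(y)=y.$$ In particular, $\Psi_\lambda(y)=y$ implies that $\Gamma_\lambda(y,\cdot)\in\Pi_r$ is a regular relaxed equilibrium for $J_\lambda$.
   Context: Setting (discrete time). $\mathbb N_0=\mathbb N\cup\{0\}$. Fix $\ell,d\in\mathbb N$; $U\subset\mathbb R^\ell$ is compact with Lebesgue measure $\mathrm{Leb}(U)>0$; $\mathcal S=\{1,\dots,d\}$. For each $u\in U$, $p^u=(p^u_{ij})_{i,j\in\mathcal S}$ is a stochastic matrix and $p^u_i\in\mathbb R^d$ is its $i$-th row. $\mathcal P(U)$ is the set of Borel probability measures on $U$, $\mathcal D(U)$ the set of probability density functions on $U$ (w.r.t. Lebesgue measure, identified when a.e. equal). A relaxed feedback control is a map $\pi:\mathcal S\to\mathcal P(U)$; $\Pi$ is the set of all of them. Under $\pi$, $X^\pi=(X^\pi_k)_{k\in\mathbb N_0}$ is the $\mathcal S$-valued Markov chain such that, given $X_t=i$, an action $u$ is sampled from $\pi(i)$ and $X_{t+1}=j$ with probability $p^u_{ij}$ (so its transition probabilities are $\int_U p^u_{ij}\,\pi(i)(du)$). $\mathbb E_i$ is expectation given $X_0=i$. The reward is $f:[0,\infty)\times\mathcal S\times U\to\mathbb R$, and $f^\mu(t,i):=\int_U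 f(t,i,u)\mu(du)$ for $\mu\in\mathcal P(U)$. The maps $u\mapsto f(t,i,u)$ and $u\mapsto p^u_i$ are Borel measurable. The discount function $\delta:[0,\infty)\to[0,1]$ is nonincreasing with $\delta(0)=1$. For $\rho\in\mathcal D(U)$, $\mathcal H(\rho):=-\int_U\ln(\rho(u))\rho(u)\,du$. $\Pi_r$ is the set of regular relaxed feedback controls: those $\pi\in\Pi$ such that each $\pi(i)$ has a density in $\mathcal D(U)$ (identified with $\pi(i)$) with $\mathcal H(\pi(i))>-\infty$. For $\lambda>0$, $\pi\in\Pi_r$, $i\in\mathcal S$: $$J^\pi_\lambda(i):=\mathbb E_i\Big[\sum_{k=0}^\infty\big(f^{\pi(X^\pi_k)}(k,X^\pi_k)+\lambda\delta(k)\mathcal H(\pi(X^\pi_k))\big)\Big],$$ $$V^\pi_\lambda(i):=\mathbb E_i\Big[\sum_{k=0}^\infty\big(f^{\pi(X^\pi_k)}(1+k,X^\pi_k)+\lambda\delta(1+k)\mathcal H(\pi(X^\pi_k))\big)\Big],$$ with $V^\pi_\lambda=(V^\pi_\lambda(1),\dots,V^\pi_\lambda(d))\in\mathbb R^d$. For $\pi,\pi'$, $\pi'\otimes_1\pi$ means using $\pi'$ at time $0$ and $\pi$ at all times $\ge1$ (both for sampling actions and for the reward/entropy terms); $J_\lambda^{\pi'\otimes_1\pi}$ is the corresponding value. $\pi\in\Pi_r$ is a regular relaxed equilibrium (for $J_\lambda$) if $J_\lambda^{\pi'\otimes_1\pi}(i)\le J_\lambda^\pi(i)$ for all $i\in\mathcal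 S$ and $\pi'\in\Pi_r$. $\Gamma_\lambda:\mathbb R^d\times\mathcal S\to\mathcal D(U)$ is $$\Gamma_\lambda(y,i)(u):=\frac{e^{\frac1\lambda(f(0,i,u)+p^u_i\cdot y)}}{\int_U e^{\frac1\lambda(f(0,i,v)+p^v_i\cdot y)}dv},$$ and $\Psi_\lambda:\mathbb R^d\to\mathbb R^d$ is $\Psi_\lambda(y):=V_\lambda^{\Gamma_\lambda(y,\cdot)}$. *)

theory Defs
  imports "HOL-Probability.Probability"
begin

text \<open>
  The action space is a set \<open>U\<close> of vectors in \<open>real^'l\<close>, the state space is the finite type \<open>'d\<close>.
  The transition matrix of action \<open>u\<close> is \<open>p u\<close>, with \<open>i\<close>-th row \<open>p u $ i\<close>.  Only the values of
  \<open>f t i u\<close>, \<open>\<delta> t\<close> for \<open>t \<ge> 0\<close> and of \<open>f t i u\<close>, \<open>p u\<close> for \<open>u \<in> U\<close> are meaningful.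
\<close>

definition stochastic_matrix :: "real^'d^'d \<Rightarrow> bool" where
  "stochastic_matrix A \<longleftrightarrow> (\<forall>i j. 0 \<le> A $ i $ j) \<and> (\<forall>i. (\<Sum>j\<in>UNIV. A $ i $ j) = 1)"

section \<open>Relaxed controls and entropy\<close>

definition borel_probs :: "(real^'l) set \<Rightarrow> (real^'l) measure set" where
  "borel_probs U = {\<mu>. prob_space \<mu> \<and> sets \<mu> = sets (restrict_space borel U)}"

definition densities :: "(real^'l) set \<Rightarrow> (real^'l \<Rightarrow> real) set" where
  "densities U = {\<rho>. \<rho> \<in> borel_measurable (restrict_space borel U) \<and> (\<forall>u\<in>U. 0 \<le> \<rho> u) \<and>
     (\<integral>\<^sup>+u. ennreal (\<rho> u) \<partial>restrict_space lborel U) = 1}"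

definition density_measure :: "(real^'l) set \<Rightarrow> (real^'l \<Rightarrow> real) \<Rightarrow> (real^'l) measure" where
  "density_measure U \<rho> = density (restrict_space lborel U) (\<lambda>u. ennreal (\<rho> u))"

text \<open>
  Differential entropy with values in the extended reals: the integral of the negative part minus
  that of the positive part of \<open>\<rho> ln \<rho>\<close>.  The former is finite whenever \<open>U\<close> has finite Lebesgue
  measure, because \<open>x ln x \<ge> - 1/e\<close>; since \<open>ln 0 = 0\<close>, the convention \<open>0 ln 0 = 0\<close> holds.
\<close>

definition diff_entropy :: "(real^'l) set \<Rightarrow> (real^'l \<Rightarrow> real) \<Rightarrow> ereal" where
  "diff_entropy U \<rho> =
     enn2ereal (\<integral>\<^sup>+u. ennreal (- (ln (\<rho> u) * \<rho> u)) \<partial>restrict_space lborel U)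
     - enn2ereal (\<integral>\<^sup>+u. ennreal (ln (\<rho> u) * \<rho> u) \<partial>restrict_space lborel U)"

definition relaxed_controls :: "(real^'l) set \<Rightarrow> ('d \<Rightarrow> (real^'l) measure) set" where
  "relaxed_controls U = {\<pi>. \<forall>i. \<pi> i \<in> borel_probs U}"

definition regular_controls :: "(real^'l) set \<Rightarrow> ('d \<Rightarrow> (real^'l) measure) set" where
  "regular_controls U = {\<pi> \<in> relaxed_controls U.
     \<forall>i. \<exists>\<rho>\<in>densities U. \<pi> i = density_measure U \<rho> \<and> diff_entropy U \<rho> > -\<infinity>}"

text \<open>
  The entropy of a measure is that of any of its densities; the choice is irrelevant by the
  lemma \<open>diff_entropy_unique\<close> below.  On regular controls it is a real number.
\<close>

definition density_of :: "(real^'l) set \<Rightarrow> (real^'l) measure \<Rightarrow> real^'l \<Rightarrow> real" where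
  "density_of U \<mu> = (SOME \<rho>. \<rho> \<in> densities U \<and> \<mu> = density_measure U \<rho>)"

definition entropy_of :: "(real^'l) set \<Rightarrow> (real^'l) measure \<Rightarrow> real" where
  "entropy_of U \<mu> = real_of_ereal (diff_entropy U (density_of U \<mu>))"

lemma diff_entropy_unique:
  assumes "\<rho> \<in> densities U" "\<rho>' \<in> densities U"
    and eq: "density_measure U \<rho> = density_measure U \<rho>'"
  shows "diff_entropy U \<rho> = diff_entropy U \<rho>'"
proof -
  let ?L = "restrict_space lborel U"
  have sets_L: "sets ?L = sets (restrict_space borel U)"
    by (rule sets_restrict_space_cong) simp
  have space_L: "space ?L = U"
    by (simp add: space_restrict_space)
  have m: "\<rho> \<in> borel_measurable ?L" "\<rho>' \<in> borel_measurable ?L"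
    using assms(1,2) by (simp_all add: densities_def measurable_cong_sets[OF sets_L refl])
  have nn: "\<And>u. u \<in> U \<Longrightarrow> 0 \<le> \<rho> u" "\<And>u. u \<in> U \<Longrightarrow> 0 \<le> \<rho>' u"
    using assms(1,2) by (simp_all add: densities_def)
  have int: "(\<integral>\<^sup>+u. ennreal (\<rho> u) \<partial>?L) \<noteq> \<infinity>"
    using assms(1) by (simp add: densities_def)
  have m': "(\<lambda>u. ennreal (\<rho> u)) \<in> borel_measurable ?L" "(\<lambda>u. ennreal (\<rho>' u)) \<in> borel_measurable ?L"
    by (rule measurable_compose[OF _ measurable_ennreal], rule m)+
  have "AE u in ?L. ennreal (\<rho> u) = ennreal (\<rho>' u)"
    using finite_density_unique[OF m' _ _ int] eq by (simp add: density_measure_def)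
  then have ae: "AE u in ?L. \<rho> u = \<rho>' u"
    using AE_space by eventually_elim (simp add: space_L nn)
  have "(\<integral>\<^sup>+u. ennreal (- (ln (\<rho> u) * \<rho> u)) \<partial>?L) = (\<integral>\<^sup>+u. ennreal (- (ln (\<rho>' u) * \<rho>' u)) \<partial>?L)"
    by (rule nn_integral_cong_AE) (use ae in eventually_elim, simp)
  moreover have "(\<integral>\<^sup>+u. ennreal (ln (\<rho> u) * \<rho> u) \<partial>?L) = (\<integral>\<^sup>+u. ennreal (ln (\<rho>' u) * \<rho>' u) \<partial>?L)"
    by (rule nn_integral_cong_AE) (use ae in eventually_elim, simp)
  ultimately show ?thesis
    by (simp add: diff_entropy_def)
qed

section \<open>The controlled Markov chain\<close>

text \<open>
  Controls may depend on time here (\<open>\<sigma> k\<close> is used at time \<open>k\<close>), so that the concatenation of two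
  controls is covered.
\<close>

definition next_state :: "(real^'l \<Rightarrow> real^'d^'d) \<Rightarrow> (real^'l) measure \<Rightarrow> 'd \<Rightarrow> 'd pmf" where
  "next_state p \<mu> i = embed_pmf (\<lambda>j. \<integral>u. p u $ i $ j \<partial>\<mu>)"

lemma pmf_next_state:
  assumes p: "\<And>u. u \<in> U \<Longrightarrow> stochastic_matrix (p u)"
    and meas: "(\<lambda>u. p u $ i) \<in> borel_measurable (restrict_space borel U)"
    and \<mu>: "\<mu> \<in> borel_probs U"
  shows "pmf (next_state p \<mu> i) j = (\<integral>u. p u $ i $ j \<partial>\<mu>)"
proof -
  interpret prob_space \<mu>
    using \<mu> by (simp add: borel_probs_def)
  have sets: "sets \<mu> = sets (restrict_space borel U)"
    using \<mu> by (simp add: borel_probs_def)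
  have space: "space \<mu> = U"
    using sets_eq_imp_space_eq[OF sets] by (simp add: space_restrict_space)
  have nn: "0 \<le> p u $ i $ j" if "u \<in> U" for u j
    using p[OF that] by (simp add: stochastic_matrix_def)
  have sum1: "(\<Sum>j\<in>UNIV. p u $ i $ j) = 1" if "u \<in> U" for u
    using p[OF that] by (simp add: stochastic_matrix_def)
  have le1: "p u $ i $ j \<le> 1" if "u \<in> U" for u j
    using member_le_sum[of j UNIV "\<lambda>j. p u $ i $ j"] nn[OF that] sum1[OF that] by simp
  have m: "(\<lambda>u. p u $ i $ j) \<in> borel_measurable \<mu>" for j
  proof -
    have "(\<lambda>u. p u $ i) \<in> borel_measurable \<mu>"
      using meas by (simp add: measurable_cong_sets[OF sets refl])
    moreover have "(\<lambda>v::real^_. v $ j) \<in> borel_measurable borel"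
      by (rule borel_measurable_continuous_onI) (rule linear_continuous_on[OF bounded_linear_vec_nth])
    ultimately show ?thesis
      by (rule measurable_compose)
  qed
  have int: "integrable \<mu> (\<lambda>u. p u $ i $ j)" for j
    by (rule integrable_const_bound[where B = 1, OF AE_I2 m]) (simp add: space nn le1)
  have nnint: "0 \<le> (\<integral>u. p u $ i $ j \<partial>\<mu>)" for j
    by (rule integral_nonneg_AE[OF AE_I2]) (simp add: space nn)
  have "(\<Sum>j\<in>UNIV. \<integral>u. p u $ i $ j \<partial>\<mu>) = (\<integral>u. (\<Sum>j\<in>UNIV. p u $ i $ j) \<partial>\<mu>)"
    by (rule Bochner_Integration.integral_sum[symmetric]) (rule int)
  also have "\<dots> = (\<integral>u. 1 \<partial>\<mu>)"
    by (rule Bochner_Integration.integral_cong) (simp_all add: space sum1)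
  also have "\<dots> = 1"
    by (simp add: prob_space)
  finally have sum_eq: "(\<Sum>j\<in>UNIV. \<integral>u. p u $ i $ j \<partial>\<mu>) = 1" .
  have "(\<integral>\<^sup>+j. ennreal (\<integral>u. p u $ i $ j \<partial>\<mu>) \<partial>count_space UNIV) = 1"
    using sum_ennreal[of UNIV "\<lambda>j. \<integral>u. p u $ i $ j \<partial>\<mu>"] nnint sum_eq
    by (simp add: nn_integral_count_space_finite)
  then show ?thesis
    unfolding next_state_def by (intro pmf_embed_pmf nnint)
qed

definition chain_kernel ::
    "(real^'l \<Rightarrow> real^'d^'d) \<Rightarrow> (nat \<Rightarrow> 'd \<Rightarrow> (real^'l) measure) \<Rightarrow> 'd \<Rightarrow> nat \<Rightarrow> (nat \<Rightarrow> 'd) \<Rightarrow> 'd measure" where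
  "chain_kernel p \<sigma> i n \<omega> = measure_pmf (case n of
       0 \<Rightarrow> return_pmf i
     | Suc k \<Rightarrow> next_state p (\<sigma> k (\<omega> k)) (\<omega> k))"

lemma Ionescu_Tulcea_chain_kernel:
  "Ionescu_Tulcea (chain_kernel p \<sigma> i) (\<lambda>_. count_space UNIV)"
proof
  fix n
  show "chain_kernel p \<sigma> i n \<in> Pi\<^sub>M {0..<n} (\<lambda>_. count_space UNIV) \<rightarrow>\<^sub>M subprob_algebra (count_space UNIV)"
  proof (cases n)
    case 0
    then show ?thesis
      unfolding chain_kernel_def
      by (auto intro!: measurable_const simp: space_subprob_algebra measure_pmf.subprob_space_axioms)
  next
    case (Suc k)
    have "(\<lambda>\<omega>. \<omega> k) \<in> Pi\<^sub>M {0..<n} (\<lambda>_. count_space UNIV) \<rightarrow>\<^sub>M count_space UNIV"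
      using Suc by (intro measurable_component_singleton) auto
    moreover have "(\<lambda>s. measure_pmf (next_state p (\<sigma> k s) s))
        \<in> count_space UNIV \<rightarrow>\<^sub>M subprob_algebra (count_space UNIV)"
      by (auto simp: space_subprob_algebra measure_pmf.subprob_space_axioms)
    ultimately show ?thesis
      unfolding chain_kernel_def Suc by (simp add: measurable_compose)
  qed
qed (auto simp: chain_kernel_def measure_pmf.prob_space_axioms)

text \<open>
  The law, on the path space \<open>nat \<Rightarrow> 'd\<close>, of the chain started in \<open>i\<close>: the projective limit given by
  the Ionescu-Tulcea theorem.
\<close>

definition chain_law ::
    "(real^'l \<Rightarrow> real^'d^'d) \<Rightarrow> (nat \<Rightarrow> 'd \<Rightarrow> (real^'l) measure) \<Rightarrow> 'd \<Rightarrow> (nat \<Rightarrow> 'd) measure" where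
  "chain_law p \<sigma> i = projective_family.lim UNIV
     (Ionescu_Tulcea.CI (chain_kernel p \<sigma> i) (\<lambda>_. count_space UNIV)) (\<lambda>_. count_space UNIV)"

text \<open>Its finite-dimensional distributions are those of the Markov chain.\<close>

lemma emeasure_chain_law:
  fixes x :: "nat \<Rightarrow> 'd::finite"
  shows "emeasure (chain_law p \<sigma> i) {\<omega>. \<forall>k<n. \<omega> k = x k} =
     (\<Prod>k<n. emeasure (chain_kernel p \<sigma> i k x) {x k})"
proof -
  interpret IT: Ionescu_Tulcea "chain_kernel p \<sigma> i" "\<lambda>_. count_space UNIV"
    by (rule Ionescu_Tulcea_chain_kernel)
  let ?P = "\<lambda>n. Pi\<^sub>M {0..<n} (\<lambda>_. count_space (UNIV :: 'd set))"
  let ?r = "\<lambda>n. restrict x {0..<n}"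
  have r_sets: "{?r n} \<in> sets (?P n)" for n
  proof -
    have "{?r n} = (\<Pi>\<^sub>E k\<in>{0..<n}. {?r n k})"
      by (rule PiE_singleton[symmetric]) simp
    also have "\<dots> \<in> sets (?P n)"
      by (rule sets_PiM_I_finite) auto
    finally show ?thesis .
  qed
  have u: "(\<lambda>_. undefined) \<in> space (?P 0)"
    by (simp add: space_PiM PiE_def extensional_def)
  have C: "emeasure (IT.C 0 n (\<lambda>_. undefined)) {?r n} = (\<Prod>k<n. emeasure (chain_kernel p \<sigma> i k x) {x k})" for n
  proof (induction n)
    case 0
    have "?r 0 = (\<lambda>_. undefined)" by (auto simp: restrict_def)
    then show ?case using r_sets[of 0] by simp
  next
    case (Suc m)
    have sC: "space (IT.C 0 m (\<lambda>_. undefined)) = space (?P m)"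
      using IT.space_C[OF u, of m] by simp
    have setsC: "sets (IT.C 0 m (\<lambda>_. undefined)) = sets (?P m)"
      using IT.sets_C[OF u, of m] by simp
    have eP: "IT.eP m \<in> IT.C 0 m (\<lambda>_. undefined) \<rightarrow>\<^sub>M subprob_algebra (?P (Suc m))"
      using IT.measurable_eP[of m] by (simp add: measurable_cong_sets[OF setsC refl])
    have ne: "space (IT.C 0 m (\<lambda>_. undefined)) \<noteq> {}"
      by (rule prob_space.not_empty[OF IT.prob_space_C[OF u]])
    have step: "emeasure (IT.eP m y) {?r (Suc m)} =
        emeasure (chain_kernel p \<sigma> i m x) {x m} * indicator {?r m} y"
      if y: "y \<in> space (?P m)" for y
    proof -
      have "y \<in> extensional {0..<m}"
        using y by (simp add: space_PiM PiE_def)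
      then have "fun_upd y m z = ?r (Suc m) \<longleftrightarrow> y = ?r m \<and> z = x m" for z
        by (auto simp: fun_eq_iff extensional_def restrict_def less_Suc_eq)
      then have vi: "(fun_upd y m) -` {?r (Suc m)} = (if y = ?r m then {x m} else {})"
        by auto
      have "chain_kernel p \<sigma> i m (?r m) = chain_kernel p \<sigma> i m x"
        by (simp add: chain_kernel_def split: nat.split)
      then show ?thesis
        by (subst IT.emeasure_eP[OF y r_sets]) (auto simp: vi)
    qed
    have "emeasure (IT.C 0 (Suc m) (\<lambda>_. undefined)) {?r (Suc m)} =
        (\<integral>\<^sup>+y. emeasure (IT.eP m y) {?r (Suc m)} \<partial>IT.C 0 m (\<lambda>_. undefined))"
      using emeasure_bind[OF ne eP r_sets] by simp
    also have "\<dots> = (\<integral>\<^sup>+y. emeasure (chain_kernel p \<sigma> i m x) {x m} * indicator {?r m} y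
        \<partial>IT.C 0 m (\<lambda>_. undefined))"
      by (rule nn_integral_cong) (simp add: step sC)
    also have "\<dots> = emeasure (chain_kernel p \<sigma> i m x) {x m} * emeasure (IT.C 0 m (\<lambda>_. undefined)) {?r m}"
      by (rule nn_integral_cmult_indicator) (simp add: setsC r_sets)
    finally show ?case
      unfolding Suc.IH lessThan_Suc by (simp add: mult.commute del: IT.C.simps restrict_apply)
  qed
  have e1: "prod_emb UNIV (\<lambda>_. count_space UNIV) {0..<n} {?r n} = {\<omega>. \<forall>k<n. \<omega> k = x k}"
  proof -
    have "restrict \<omega> {0..<n} = ?r n \<longleftrightarrow> (\<forall>k<n. \<omega> k = x k)" for \<omega>
    proof
      assume eq: "restrict \<omega> {0..<n} = ?r n"
      show "\<forall>k<n. \<omega> k = x k"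
      proof (intro allI impI)
        fix k assume "k < n"
        then show "\<omega> k = x k" using fun_cong[OF eq, of k] by simp
      qed
    next
      assume "\<forall>k<n. \<omega> k = x k"
      then show "restrict \<omega> {0..<n} = ?r n" by (intro restrict_ext) simp
    qed
    then show ?thesis
      unfolding prod_emb_def vimage_def space_PiM by (simp del: restrict_apply)
  qed
  have e2: "prod_emb {0..<n} (\<lambda>_. count_space UNIV) {0..<n} {?r n} = {?r n}"
    by (rule prod_emb_id) (simp add: PiE_iff)
  have "emeasure (chain_law p \<sigma> i) {\<omega>. \<forall>k<n. \<omega> k = x k} = emeasure (IT.CI {0..<n}) {?r n}"
    unfolding chain_law_def e1[symmetric] by (rule IT.lim[OF _ r_sets]) simp
  also have "\<dots> = emeasure (IT.C 0 n (\<lambda>_. undefined)) {?r n}"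
    unfolding IT.emeasure_CI[OF subset_refl r_sets] e2 ..
  finally show ?thesis
    unfolding C .
qed

section \<open>Value functions and equilibria\<close>

definition mean_reward ::
    "(real \<Rightarrow> 'd \<Rightarrow> real^'l \<Rightarrow> real) \<Rightarrow> (real^'l) measure \<Rightarrow> real \<Rightarrow> 'd \<Rightarrow> real" where
  "mean_reward f \<mu> t i = (\<integral>u. f t i u \<partial>\<mu>)"

text \<open>Here \<open>s\<close> is the shift of the time argument of reward and discount: 0 for J and 1 for V.\<close>

definition shifted_value ::
    "(real^'l) set \<Rightarrow> (real^'l \<Rightarrow> real^'d^'d) \<Rightarrow> (real \<Rightarrow> 'd \<Rightarrow> real^'l \<Rightarrow> real) \<Rightarrow> (real \<Rightarrow> real) \<Rightarrow> real
     \<Rightarrow> real \<Rightarrow> (nat \<Rightarrow> 'd \<Rightarrow> (real^'l) measure) \<Rightarrow> 'd \<Rightarrow> real" where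
  "shifted_value U p f \<delta> lam s \<sigma> i =
     (\<integral>\<omega>. (\<Sum>k. mean_reward f (\<sigma> k (\<omega> k)) (s + real k) (\<omega> k)
                + lam * \<delta> (s + real k) * entropy_of U (\<sigma> k (\<omega> k))) \<partial>chain_law p \<sigma> i)"

definition J_value ::
    "(real^'l) set \<Rightarrow> (real^'l \<Rightarrow> real^'d^'d) \<Rightarrow> (real \<Rightarrow> 'd \<Rightarrow> real^'l \<Rightarrow> real) \<Rightarrow> (real \<Rightarrow> real) \<Rightarrow> real
     \<Rightarrow> (nat \<Rightarrow> 'd \<Rightarrow> (real^'l) measure) \<Rightarrow> 'd \<Rightarrow> real" where
  "J_value U p f \<delta> lam \<sigma> i = shifted_value U p f \<delta> lam 0 \<sigma> i"

definition V_value ::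
    "(real^'l) set \<Rightarrow> (real^'l \<Rightarrow> real^'d^'d) \<Rightarrow> (real \<Rightarrow> 'd \<Rightarrow> real^'l \<Rightarrow> real) \<Rightarrow> (real \<Rightarrow> real) \<Rightarrow> real
     \<Rightarrow> ('d \<Rightarrow> (real^'l) measure) \<Rightarrow> real^'d" where
  "V_value U p f \<delta> lam \<pi> = (\<chi> i. shifted_value U p f \<delta> lam 1 (\<lambda>_. \<pi>) i)"

definition concat1 :: "'c \<Rightarrow> 'c \<Rightarrow> nat \<Rightarrow> 'c" where
  "concat1 \<pi>' \<pi> k = (if k = 0 then \<pi>' else \<pi>)"

definition regular_equilibrium ::
    "(real^'l) set \<Rightarrow> (real^'l \<Rightarrow> real^'d^'d) \<Rightarrow> (real \<Rightarrow> 'd \<Rightarrow> real^'l \<Rightarrow> real) \<Rightarrow> (real \<Rightarrow> real) \<Rightarrow> real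
     \<Rightarrow> ('d \<Rightarrow> (real^'l) measure) \<Rightarrow> bool" where
  "regular_equilibrium U p f \<delta> lam \<pi> \<longleftrightarrow> \<pi> \<in> regular_controls U \<and>
     (\<forall>i. \<forall>\<pi>'\<in>regular_controls U.
        J_value U p f \<delta> lam (concat1 \<pi>' \<pi>) i \<le> J_value U p f \<delta> lam (\<lambda>_. \<pi>) i)"

definition gibbs_density ::
    "(real^'l) set \<Rightarrow> (real^'l \<Rightarrow> real^'d^'d) \<Rightarrow> (real \<Rightarrow> 'd \<Rightarrow> real^'l \<Rightarrow> real) \<Rightarrow> real
     \<Rightarrow> real^'d \<Rightarrow> 'd \<Rightarrow> real^'l \<Rightarrow> real" where
  "gibbs_density U p f lam y i u =
     exp (1 / lam * (f 0 i u + p u $ i \<bullet> y))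
     / (\<integral>v. exp (1 / lam * (f 0 i v + p v $ i \<bullet> y)) \<partial>restrict_space lborel U)"

definition gibbs_control ::
    "(real^'l) set \<Rightarrow> (real^'l \<Rightarrow> real^'d^'d) \<Rightarrow> (real \<Rightarrow> 'd \<Rightarrow> real^'l \<Rightarrow> real) \<Rightarrow> real
     \<Rightarrow> real^'d \<Rightarrow> 'd \<Rightarrow> (real^'l) measure" where
  "gibbs_control U p f lam y i = density_measure U (gibbs_density U p f lam y i)"

definition Psi ::
    "(real^'l) set \<Rightarrow> (real^'l \<Rightarrow> real^'d^'d) \<Rightarrow> (real \<Rightarrow> 'd \<Rightarrow> real^'l \<Rightarrow> real) \<Rightarrow> (real \<Rightarrow> real) \<Rightarrow> real
     \<Rightarrow> real^'d \<Rightarrow> real^'d" where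
  "Psi U p f \<delta> lam y = V_value U p f \<delta> lam (gibbs_control U p f lam y)"

end

theory Submission
  imports Defs
begin

text \<open>
  First-step analysis of the chain gives
  \<open>J(\<pi>' \<otimes>\<^sub>1 \<pi>)(i) = \<integral> (f 0 i u + p u $ i \<bullet> V(\<pi>)) \<pi>'(i)(du) + \<lambda> H(\<pi>'(i))\<close>, which depends on \<open>\<pi>'\<close>
  only through \<open>\<pi>'(i)\<close>.  By the Gibbs variational principle it is at most \<open>\<lambda> ln Z\<close>, with equality
  exactly at the Gibbs measure.  Hence \<open>\<pi>\<close> is an equilibrium iff \<open>\<pi> = \<Gamma>(V(\<pi>))\<close>, and the fixed
  points of \<open>\<Psi> = V \<circ> \<Gamma>\<close> correspond to the fixed points of \<open>\<Gamma> \<circ> V\<close>.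
\<close>

section \<open>First-step analysis of the chain\<close>

lemma sets_chain_law: "sets (chain_law p \<sigma> i) = sets (Pi\<^sub>M UNIV (\<lambda>_. count_space UNIV))"
proof -
  interpret IT: Ionescu_Tulcea "chain_kernel p \<sigma> i" "\<lambda>_. count_space UNIV"
    by (rule Ionescu_Tulcea_chain_kernel)
  show ?thesis
    unfolding chain_law_def by simp
qed

lemma space_chain_law: "space (chain_law p \<sigma> i) = UNIV"
  using sets_eq_imp_space_eq[OF sets_chain_law] by (simp add: space_PiM)

text \<open>The cylinder of length 0 is the whole path space, and the product giving its mass is
  empty.\<close>

lemma prob_space_chain_law: "prob_space (chain_law p \<sigma> (i::'d::finite))"
  by (rule prob_spaceI) (use emeasure_chain_law[of p \<sigma> i 0] in \<open>simp add: space_chain_law\<close>)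

lemma measurable_chain_coordinate [measurable]:
  "(\<lambda>\<omega>. \<omega> k) \<in> chain_law p \<sigma> i \<rightarrow>\<^sub>M count_space UNIV"
  by (simp add: measurable_cong_sets[OF sets_chain_law refl])

lemma integrable_chain_coordinate:
  fixes g :: "'d::finite \<Rightarrow> real"
  shows "integrable (chain_law p \<sigma> i) (\<lambda>\<omega>. g (\<omega> k))"
proof -
  interpret prob_space "chain_law p \<sigma> i" by (rule prob_space_chain_law)
  show ?thesis
  proof (rule integrable_const_bound[where B = "\<Sum>j\<in>UNIV. \<bar>g j\<bar>"])
    show "AE \<omega> in chain_law p \<sigma> i. norm (g (\<omega> k)) \<le> (\<Sum>j\<in>UNIV. \<bar>g j\<bar>)"
      by (intro AE_I2) (simp add: member_le_sum[of _ UNIV "\<lambda>j. \<bar>g j\<bar>"])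
  qed measurable
qed

text \<open>Each summand of the value functions looks at a single coordinate of the path, so these
  one-dimensional distributions determine every expectation needed. This replaces a Markov property
  for shifted paths by finite sums over states.\<close>

definition marginal ::
    "(real^'l \<Rightarrow> real^'d^'d) \<Rightarrow> (nat \<Rightarrow> 'd \<Rightarrow> (real^'l) measure) \<Rightarrow> 'd \<Rightarrow> nat \<Rightarrow> 'd::finite \<Rightarrow> real" where
  "marginal p \<sigma> i n j = measure (chain_law p \<sigma> i) {\<omega>. \<omega> n = j}"

lemma sets_chain_pred:
  assumes "Measurable.pred (chain_law p \<sigma> i) P"
  shows "{\<omega>. P \<omega>} \<in> sets (chain_law p \<sigma> i)"
  using assms by (simp add: pred_def space_chain_law)

lemma integral_chain_coordinate:
  fixes g :: "'d::finite \<Rightarrow> real"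
  shows "(\<integral>\<omega>. g (\<omega> n) \<partial>chain_law p \<sigma> i) = (\<Sum>j\<in>UNIV. marginal p \<sigma> i n j * g j)"
proof -
  interpret prob_space "chain_law p \<sigma> i" by (rule prob_space_chain_law)
  have [measurable]: "{\<omega>. \<omega> n = j} \<in> sets (chain_law p \<sigma> i)" for j
    by (rule sets_chain_pred) measurable
  have "(\<integral>\<omega>. g (\<omega> n) \<partial>chain_law p \<sigma> i) =
      (\<integral>\<omega>. (\<Sum>j\<in>UNIV. indicator {\<omega>. \<omega> n = j} \<omega> * g j) \<partial>chain_law p \<sigma> i)"
    by (rule Bochner_Integration.integral_cong) (auto simp: indicator_def if_distrib cong: if_cong)
  also have "\<dots> = (\<Sum>j\<in>UNIV. (\<integral>\<omega>. indicator {\<omega>. \<omega> n = j} \<omega> * g j \<partial>chain_law p \<sigma> i))"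
    by (rule Bochner_Integration.integral_sum) (auto intro!: integrable_real_indicator simp: less_top[symmetric])
  also have "\<dots> = (\<Sum>j\<in>UNIV. marginal p \<sigma> i n j * g j)"
    by (simp add: marginal_def space_chain_law)
  finally show ?thesis .
qed

section \<open>Forward and backward equations for the marginals\<close>

lemma marginal_0: "marginal p \<sigma> i 0 j = of_bool (j = i)"
proof -
  have "{\<omega>. \<omega> 0 = j} = {\<omega>. \<forall>k<1::nat. \<omega> k = j}"
    by auto
  then show ?thesis
    using emeasure_chain_law[of p \<sigma> i 1 "\<lambda>_. j"]
    by (simp add: marginal_def measure_def chain_kernel_def)
qed

text \<open>Cylinders over all prefixes of length \<open>n\<close> partition path space. There are
  finitely many of them since the state type is finite, and indexing by extensional functions
  ensures that distinct indices give disjoint cylinders.\<close>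

lemma measure_chain_split_prefix:
  assumes "A \<in> sets (chain_law p \<sigma> (i::'d::finite))"
  shows "measure (chain_law p \<sigma> i) A =
    (\<Sum>x\<in>{..<n} \<rightarrow>\<^sub>E UNIV. measure (chain_law p \<sigma> i) (A \<inter> {\<omega>. \<forall>k<n. \<omega> k = x k}))"
proof -
  interpret prob_space "chain_law p \<sigma> i" by (rule prob_space_chain_law)
  let ?B = "\<lambda>x. A \<inter> {\<omega>. \<forall>k<n. \<omega> k = x k}"
  have "A = (\<Union>x\<in>{..<n} \<rightarrow>\<^sub>E UNIV. ?B x)"
  proof (intro equalityI subsetI)
    fix \<omega> assume "\<omega> \<in> A"
    then show "\<omega> \<in> (\<Union>x\<in>{..<n} \<rightarrow>\<^sub>E UNIV. ?B x)"
      by (intro UN_I[of "restrict \<omega> {..<n}"]) auto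
  next
    fix \<omega> assume "\<omega> \<in> (\<Union>x\<in>{..<n} \<rightarrow>\<^sub>E UNIV. ?B x)"
    then show "\<omega> \<in> A" by (elim UN_E IntE)
  qed
  then have "measure (chain_law p \<sigma> i) A = measure (chain_law p \<sigma> i) (\<Union>x\<in>{..<n} \<rightarrow>\<^sub>E UNIV. ?B x)"
    by simp
  also have "\<dots> = (\<Sum>x\<in>{..<n} \<rightarrow>\<^sub>E UNIV. measure (chain_law p \<sigma> i) (?B x))"
  proof (rule finite_measure_finite_Union)
    show "finite ({..<n} \<rightarrow>\<^sub>E (UNIV::'d set))" by (rule finite_PiE) auto
    have "{\<omega>. \<forall>k<n. \<omega> k = x k} \<in> sets (chain_law p \<sigma> i)" for x
      by (rule sets_chain_pred) measurable
    then show "?B ` ({..<n} \<rightarrow>\<^sub>E UNIV) \<subseteq> sets (chain_law p \<sigma> i)"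
      using assms by blast
    show "disjoint_family_on ?B ({..<n} \<rightarrow>\<^sub>E UNIV)"
      unfolding disjoint_family_on_def
    proof (intro ballI impI equals0I)
      fix x y \<omega> assume "x \<in> {..<n} \<rightarrow>\<^sub>E (UNIV::'d set)" "y \<in> {..<n} \<rightarrow>\<^sub>E (UNIV::'d set)"
        and ne: "x \<noteq> y" and \<omega>: "\<omega> \<in> ?B x \<inter> ?B y"
      then have "x = y"
        by (intro PiE_ext[of x "{..<n}" "\<lambda>_. UNIV" y]) auto
      with ne show False by simp
    qed
  qed
  finally show ?thesis .
qed

text \<open>This is the Markov property at time \<open>n\<close>. After splitting by prefixes, the
  two events become cylinders whose masses differ by one kernel factor; that factor does not depend
  on the prefix and leaves the sum.\<close>

lemma measure_chain_step:
  "measure (chain_law p \<sigma> i) {\<omega>. \<omega> n = a \<and> \<omega> (Suc n) = b} =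
     marginal p \<sigma> i n a * pmf (next_state p (\<sigma> n a) a) b"
proof -
  let ?M = "chain_law p \<sigma> i"
  let ?X = "{..<n} \<rightarrow>\<^sub>E (UNIV :: 'd set)"
  let ?cyl = "\<lambda>m x. {\<omega>. \<forall>k<m. \<omega> k = x k} :: (nat \<Rightarrow> 'd) set"
  let ?e = "\<lambda>x. x(n := a, Suc n := b)"
  have cyl: "measure ?M (?cyl (Suc m) x) =
      measure ?M (?cyl m x) * measure (chain_kernel p \<sigma> i m x) {x m}" for m x
    by (simp add: measure_def emeasure_chain_law enn2real_mult)
  have s1: "{\<omega>. \<omega> n = a \<and> \<omega> (Suc n) = b} \<in> sets ?M"
    by (rule sets_chain_pred) measurable
  have s2: "{\<omega>. \<omega> n = a} \<in> sets ?M"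
    by (rule sets_chain_pred) measurable
  have c1: "{\<omega>. \<omega> n = a \<and> \<omega> (Suc n) = b} \<inter> ?cyl n x = ?cyl (Suc (Suc n)) (?e x)" for x
    by (auto simp: less_Suc_eq)
  \<comment> \<open>A cylinder of length \<open>Suc n\<close> does not see coordinate
    \<open>Suc n\<close>, so the value \<open>b\<close> stored there by \<open>?e\<close> is
    harmless. Keeping the same \<open>?e\<close> as in \<open>c1\<close> allows \<open>cyl\<close>
    to compare both cylinders directly.\<close>
  have c2: "{\<omega>. \<omega> n = a} \<inter> ?cyl n x = ?cyl (Suc n) (?e x)" for x
    by (auto simp: less_Suc_eq)
  \<comment> \<open>The kernel at time \<open>Suc n\<close> reads only coordinate \<open>n\<close>,
    which \<open>?e\<close> has set to \<open>a\<close>.\<close>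
  have K: "measure (chain_kernel p \<sigma> i (Suc n) (?e x)) {?e x (Suc n)} = pmf (next_state p (\<sigma> n a) a) b" for x
    by (simp add: chain_kernel_def pmf.rep_eq)
  have "measure ?M {\<omega>. \<omega> n = a \<and> \<omega> (Suc n) = b} = (\<Sum>x\<in>?X. measure ?M (?cyl (Suc (Suc n)) (?e x)))"
    unfolding measure_chain_split_prefix[OF s1, of n] c1 ..
  also have "\<dots> = (\<Sum>x\<in>?X. measure ?M (?cyl (Suc n) (?e x))) * pmf (next_state p (\<sigma> n a) a) b"
    unfolding cyl[of "Suc n"] K sum_distrib_right ..
  also have "(\<Sum>x\<in>?X. measure ?M (?cyl (Suc n) (?e x))) = marginal p \<sigma> i n a"
    unfolding marginal_def measure_chain_split_prefix[OF s2, of n] c2 ..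
  finally show ?thesis .
qed

lemma marginal_Suc:
  "marginal p \<sigma> i (Suc n) b = (\<Sum>a\<in>UNIV. marginal p \<sigma> i n a * pmf (next_state p (\<sigma> n a) a) b)"
proof -
  interpret prob_space "chain_law p \<sigma> i" by (rule prob_space_chain_law)
  have "{\<omega>. \<omega> (Suc n) = b} = (\<Union>a\<in>UNIV. {\<omega>. \<omega> n = a \<and> \<omega> (Suc n) = b})"
    by auto
  moreover have "measure (chain_law p \<sigma> i) (\<Union>a\<in>UNIV. {\<omega>. \<omega> n = a \<and> \<omega> (Suc n) = b}) =
      (\<Sum>a\<in>UNIV. measure (chain_law p \<sigma> i) {\<omega>. \<omega> n = a \<and> \<omega> (Suc n) = b})"
    by (rule finite_measure_finite_Union)
      (auto simp: disjoint_family_on_def intro!: sets_chain_pred)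
  ultimately show ?thesis
    by (simp add: marginal_def measure_chain_step)
qed

text \<open>\<open>marginal_Suc\<close> peels off the last transition, whereas the dynamic
  programming argument needs the first one. Induction on \<open>n\<close> with \<open>b\<close>
  arbitrary converts one into the other: expanding the last step on both sides leaves an exchange of
  two finite sums.\<close>

lemma marginal_first_step:
  "marginal p \<sigma> i (Suc n) b =
     (\<Sum>j\<in>UNIV. pmf (next_state p (\<sigma> 0 i) i) j * marginal p (\<lambda>k. \<sigma> (Suc k)) j n b)"
proof (induction n arbitrary: b)
  case 0
  show ?case
    by (simp add: marginal_Suc[of _ _ _ 0] marginal_0)
next
  case (Suc n)
  show ?case
    unfolding marginal_Suc[of p \<sigma> i "Suc n"] Suc.IH
      marginal_Suc[of p "\<lambda>k. \<sigma> (Suc k)" _ n] sum_distrib_left sum_distrib_right mult.assoc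
    by (rule sum.swap)
qed

text \<open>The summable bound \<open>B\<close> is uniform over paths, hence it dominates both the
  pathwise series and the series of expected absolute values; \<open>sums_integral\<close> then
  exchanges series and expectation.\<close>

lemma
  fixes r :: "nat \<Rightarrow> 'd::finite \<Rightarrow> real"
  assumes bound: "\<And>k j. \<bar>r k j\<bar> \<le> B k" and "summable B"
  shows integral_chain_suminf: "(\<integral>\<omega>. (\<Sum>k. r k (\<omega> k)) \<partial>chain_law p \<sigma> i) =
      (\<Sum>k. \<Sum>j\<in>UNIV. marginal p \<sigma> i k j * r k j)"
    and summable_chain_expectation: "summable (\<lambda>k. \<Sum>j\<in>UNIV. marginal p \<sigma> i k j * r k j)"
proof -
  interpret prob_space "chain_law p \<sigma> i" by (rule prob_space_chain_law)
  have sum1: "AE \<omega> in chain_law p \<sigma> i. summable (\<lambda>k. norm (r k (\<omega> k)))"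
    by (intro AE_I2 summable_comparison_test'[OF \<open>summable B\<close>, of 0]) (simp add: bound)
  have "norm (\<integral>\<omega>. norm (r k (\<omega> k)) \<partial>chain_law p \<sigma> i) \<le> B k" for k
  proof -
    have "(\<integral>\<omega>. norm (r k (\<omega> k)) \<partial>chain_law p \<sigma> i) \<le> (\<integral>\<omega>. B k \<partial>chain_law p \<sigma> i)"
      by (rule integral_mono) (auto simp: bound intro: integrable_chain_coordinate)
    then show ?thesis
      by (simp add: prob_space)
  qed
  then have sum2: "summable (\<lambda>k. \<integral>\<omega>. norm (r k (\<omega> k)) \<partial>chain_law p \<sigma> i)"
    by (intro summable_comparison_test'[OF \<open>summable B\<close>, of 0])
  have int: "integrable (chain_law p \<sigma> i) (\<lambda>\<omega>. r k (\<omega> k))" for k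
    by (rule integrable_chain_coordinate)
  from sums_integral[OF int sum1 sum2]
  have "(\<lambda>k. \<Sum>j\<in>UNIV. marginal p \<sigma> i k j * r k j) sums
      (\<integral>\<omega>. (\<Sum>k. r k (\<omega> k)) \<partial>chain_law p \<sigma> i)"
    by (simp add: integral_chain_coordinate)
  then show "(\<integral>\<omega>. (\<Sum>k. r k (\<omega> k)) \<partial>chain_law p \<sigma> i) =
      (\<Sum>k. \<Sum>j\<in>UNIV. marginal p \<sigma> i k j * r k j)"
    and "summable (\<lambda>k. \<Sum>j\<in>UNIV. marginal p \<sigma> i k j * r k j)"
    by (auto simp: sums_iff)
qed

text \<open>The summand at time 0 is deterministic because the chain starts in \<open>i\<close>. In
  all later summands \<open>marginal_first_step\<close> isolates the first transition, and the
  remaining marginals belong to the chain with controls shifted by one.\<close>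

lemma chain_first_step:
  fixes r :: "nat \<Rightarrow> 'd::finite \<Rightarrow> real"
  assumes bound: "\<And>k j. \<bar>r k j\<bar> \<le> B k" and "summable B"
  shows "(\<integral>\<omega>. (\<Sum>k. r k (\<omega> k)) \<partial>chain_law p \<sigma> i) =
    r 0 i + (\<Sum>j\<in>UNIV. pmf (next_state p (\<sigma> 0 i) i) j *
      (\<integral>\<omega>. (\<Sum>k. r (Suc k) (\<omega> k)) \<partial>chain_law p (\<lambda>k. \<sigma> (Suc k)) j))"
proof -
  let ?s = "\<lambda>k. \<sigma> (Suc k)"
  let ?q = "pmf (next_state p (\<sigma> 0 i) i)"
  let ?E = "\<lambda>j k. \<Sum>b\<in>UNIV. marginal p ?s j k b * r (Suc k) b"
  have shift: "(\<integral>\<omega>. (\<Sum>k. r (Suc k) (\<omega> k)) \<partial>chain_law p ?s j) = (\<Sum>k. ?E j k)" "summable (?E j)" for j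
  proof -
    have "summable (\<lambda>k. B (Suc k))"
      using \<open>summable B\<close> by (simp add: summable_Suc_iff)
    note chain = this bound[of "Suc _"]
    show "(\<integral>\<omega>. (\<Sum>k. r (Suc k) (\<omega> k)) \<partial>chain_law p ?s j) = (\<Sum>k. ?E j k)"
      by (rule integral_chain_suminf[where r = "\<lambda>k. r (Suc k)" and B = "\<lambda>k. B (Suc k)"]) (fact chain)+
    show "summable (?E j)"
      by (rule summable_chain_expectation[where r = "\<lambda>k. r (Suc k)" and B = "\<lambda>k. B (Suc k)"]) (fact chain)+
  qed
  have E: "(\<Sum>b\<in>UNIV. marginal p \<sigma> i (Suc k) b * r (Suc k) b) = (\<Sum>j\<in>UNIV. ?q j * ?E j k)" for k
    unfolding marginal_first_step sum_distrib_left sum_distrib_right mult.assoc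
    by (rule sum.swap)
  have "(\<integral>\<omega>. (\<Sum>k. r k (\<omega> k)) \<partial>chain_law p \<sigma> i) =
      (\<Sum>k. \<Sum>b\<in>UNIV. marginal p \<sigma> i k b * r k b)"
    by (rule integral_chain_suminf[OF assms])
  also have "\<dots> = (\<Sum>k. \<Sum>b\<in>UNIV. marginal p \<sigma> i (Suc k) b * r (Suc k) b) +
      (\<Sum>b\<in>UNIV. marginal p \<sigma> i 0 b * r 0 b)"
    using suminf_split_head[OF summable_chain_expectation[of r B p \<sigma> i, OF assms]] by simp
  also have "(\<Sum>b\<in>UNIV. marginal p \<sigma> i 0 b * r 0 b) = r 0 i"
    by (simp add: marginal_0)
  also have "(\<Sum>k. \<Sum>b\<in>UNIV. marginal p \<sigma> i (Suc k) b * r (Suc k) b) = (\<Sum>j\<in>UNIV. \<Sum>k. ?q j * ?E j k)"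
    unfolding E by (rule suminf_sum) (intro summable_mult shift)
  also have "\<dots> = (\<Sum>j\<in>UNIV. ?q j * (\<integral>\<omega>. (\<Sum>k. r (Suc k) (\<omega> k)) \<partial>chain_law p ?s j))"
    by (simp add: shift suminf_mult)
  finally show ?thesis by simp
qed

section \<open>Entropy and the Gibbs variational principle\<close>

text \<open>Follows from \<open>ln t \<le> t - 1\<close> at \<open>t = 1 / x\<close>. The constant
  is cruder than the optimal \<open>- 1 / e\<close>, but any finite bound suffices on a set of
  finite measure.\<close>

lemma ln_mult_self_ge:
  assumes "0 \<le> (x::real)"
  shows "- 1 \<le> ln x * x"
proof (cases "x = 0")
  case False
  with assms have "x > 0" by simp
  then have "- ln x \<le> 1 / x - 1"
    using ln_le_minus_one[of "1 / x"] by (simp add: ln_div)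
  then have "- (ln x * x) \<le> (1 / x - 1) * x"
    using mult_right_mono[of "- ln x" "1 / x - 1" x] \<open>x > 0\<close> by simp
  also have "\<dots> = 1 - x"
    using \<open>x > 0\<close> by (simp add: field_simps)
  finally show ?thesis
    using assms by simp
qed simp

text \<open>The pointwise integrand of relative entropy, with the correction \<open>- x + z\<close>
  that makes it nonnegative. For \<open>x > 0\<close> it is \<open>x * (t - 1 - ln t)\<close> with
  \<open>t = z / x\<close>; for \<open>x = 0\<close> it reduces to \<open>z > 0\<close>, so the
  equality case cannot occur there.\<close>

lemma entropy_gap:
  fixes x z :: real
  assumes "0 \<le> x" "0 < z"
  shows entropy_gap_nonneg: "0 \<le> ln x * x - ln z * x - x + z"
    and entropy_gap_eq_0: "ln x * x - ln z * x - x + z = 0 \<Longrightarrow> x = z"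
proof -
  have "0 \<le> ln x * x - ln z * x - x + z \<and> (ln x * x - ln z * x - x + z = 0 \<longrightarrow> x = z)"
  proof (cases "x = 0")
    case False
    with assms have "x > 0" by simp
    have eq: "ln x * x - ln z * x - x + z = x * (z / x - 1 - ln (z / x))"
      using \<open>x > 0\<close> \<open>0 < z\<close> by (simp add: ln_div field_simps)
    have "0 \<le> z / x - 1 - ln (z / x)"
      using ln_le_minus_one[of "z / x"] \<open>x > 0\<close> \<open>0 < z\<close> by simp
    moreover have "z = x" if "z / x - 1 - ln (z / x) = 0"
      using ln_eq_minus_one[of "z / x"] that \<open>x > 0\<close> \<open>0 < z\<close> by simp
    ultimately show ?thesis
      unfolding eq using \<open>x > 0\<close> by auto
  qed (use assms in auto)
  then show "0 \<le> ln x * x - ln z * x - x + z"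
    and "ln x * x - ln z * x - x + z = 0 \<Longrightarrow> x = z" by auto
qed

text \<open>
  Integrating \<open>entropy_gap\<close> with \<open>z = exp g / Z\<close> gives the gap between the two sides.
\<close>

lemma (in finite_measure)
  fixes g \<rho> :: "'a \<Rightarrow> real"
  defines "Z \<equiv> \<integral>u. exp (g u) \<partial>M"
  assumes Z: "Z > 0" and exp_int: "integrable M (\<lambda>u. exp (g u))"
    and \<rho>_nonneg: "\<forall>u\<in>space M. 0 \<le> \<rho> u"
    and \<rho>_int: "integrable M \<rho>" "(\<integral>u. \<rho> u \<partial>M) = 1"
    and g\<rho>_int: "integrable M (\<lambda>u. g u * \<rho> u)"
    and ent_int: "integrable M (\<lambda>u. ln (\<rho> u) * \<rho> u)"
  shows gibbs_variational_le:
      "(\<integral>u. g u * \<rho> u \<partial>M) - (\<integral>u. ln (\<rho> u) * \<rho> u \<partial>M) \<le> ln Z"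
    and gibbs_variational_unique:
      "(\<integral>u. g u * \<rho> u \<partial>M) - (\<integral>u. ln (\<rho> u) * \<rho> u \<partial>M) = ln Z \<Longrightarrow> AE u in M. \<rho> u = exp (g u) / Z"
proof -
  let ?h = "\<lambda>u. ln (\<rho> u) * \<rho> u - ln (exp (g u) / Z) * \<rho> u - \<rho> u + exp (g u) / Z"
  \<comment> \<open>Expanding the logarithm of the quotient splits the integrand into pieces covered
    by the integrability assumptions.\<close>
  have h: "?h = (\<lambda>u. ln (\<rho> u) * \<rho> u - g u * \<rho> u + (ln Z - 1) * \<rho> u + exp (g u) / Z)"
    using Z by (auto simp: ln_div algebra_simps)
  have int_h: "integrable M ?h"
    unfolding h by (intro Bochner_Integration.integrable_add Bochner_Integration.integrable_diff
      integrable_mult_right integrable_divide_zero ent_int g\<rho>_int \<rho>_int exp_int)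
  \<comment> \<open>Both \<rho> and \<open>exp (g u) / Z\<close> have integral 1, so the corrections
    \<open>- x + z\<close> cancel and only \<open>ln Z\<close> is left.\<close>
  have "integral\<^sup>L M ?h = (\<integral>u. ln (\<rho> u) * \<rho> u \<partial>M) - (\<integral>u. g u * \<rho> u \<partial>M) + (ln Z - 1) + Z / Z"
    unfolding h using ent_int g\<rho>_int \<rho>_int exp_int by (simp add: Z_def)
  then have gap: "integral\<^sup>L M ?h = ln Z - ((\<integral>u. g u * \<rho> u \<partial>M) - (\<integral>u. ln (\<rho> u) * \<rho> u \<partial>M))"
    using Z by simp
  have nonneg: "0 \<le> ?h u" if "u \<in> space M" for u
    by (rule entropy_gap_nonneg) (use Z \<rho>_nonneg that in auto)
  have "0 \<le> integral\<^sup>L M ?h"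
    by (rule Bochner_Integration.integral_nonneg) (rule nonneg)
  then show "(\<integral>u. g u * \<rho> u \<partial>M) - (\<integral>u. ln (\<rho> u) * \<rho> u \<partial>M) \<le> ln Z"
    unfolding gap by simp
  assume "(\<integral>u. g u * \<rho> u \<partial>M) - (\<integral>u. ln (\<rho> u) * \<rho> u \<partial>M) = ln Z"
  then have "integral\<^sup>L M ?h = 0"
    unfolding gap by simp
  \<comment> \<open>A nonnegative integrand with integral zero vanishes almost everywhere, and the
    equality case of \<open>entropy_gap\<close> identifies \<rho> pointwise.\<close>
  then have "AE u in M. ?h u = 0"
    using integral_nonneg_eq_0_iff_AE[OF int_h AE_I2[OF nonneg]] by simp
  moreover have "\<rho> u = exp (g u) / Z" if "u \<in> space M" "?h u = 0" for u
    using that(2) by (rule entropy_gap_eq_0[rotated 2]) (use Z \<rho>_nonneg that(1) in auto)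
  ultimately show "AE u in M. \<rho> u = exp (g u) / Z"
    using AE_space by (elim AE_mp) (rule AE_I2, blast)
qed

section \<open>Densities on \<open>U\<close> and their entropy\<close>

lemma sets_restrict_lborel: "sets (restrict_space lborel U) = sets (restrict_space borel U)"
  by (rule sets_restrict_space_cong) simp

lemma measurable_restrict_lborel:
  "borel_measurable (restrict_space lborel U) = borel_measurable (restrict_space borel U)"
  by (rule measurable_cong_sets[OF sets_restrict_lborel refl])

lemma space_borel_probs:
  assumes "\<mu> \<in> borel_probs U"
  shows "space \<mu> = U"
  using assms sets_eq_imp_space_eq[of \<mu> "restrict_space borel U"]
  by (simp add: borel_probs_def space_restrict_space)

text \<open>Passes from the nonnegative integral in the definition to the Bochner integral, the form
  needed by the variational principle; a nonnegative measurable function of finite integral is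
  integrable.\<close>

lemma densities_iff:
  "\<rho> \<in> densities U \<longleftrightarrow> (\<forall>u\<in>U. 0 \<le> \<rho> u) \<and> integrable (restrict_space lborel U) \<rho> \<and>
     (\<integral>u. \<rho> u \<partial>restrict_space lborel U) = 1"
proof -
  let ?L = "restrict_space lborel U"
  have nn: "(\<integral>\<^sup>+u. ennreal (\<rho> u) \<partial>?L) = ennreal (\<integral>u. \<rho> u \<partial>?L)"
    if "\<forall>u\<in>U. 0 \<le> \<rho> u" "integrable ?L \<rho>"
    using that by (intro nn_integral_eq_integral) (auto simp: space_restrict_space intro!: AE_I2)
  have int: "integrable ?L \<rho>"
    if "\<forall>u\<in>U. 0 \<le> \<rho> u" "\<rho> \<in> borel_measurable ?L" "(\<integral>\<^sup>+u. ennreal (\<rho> u) \<partial>?L) = 1"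
    using that by (intro integrableI_nonneg) (auto simp: space_restrict_space intro!: AE_I2)
  show ?thesis
  proof
    assume "\<rho> \<in> densities U"
    then have \<rho>: "\<forall>u\<in>U. 0 \<le> \<rho> u" "\<rho> \<in> borel_measurable ?L" "(\<integral>\<^sup>+u. ennreal (\<rho> u) \<partial>?L) = 1"
      by (simp_all add: densities_def measurable_restrict_lborel)
    from int[OF \<rho>] nn[OF \<rho>(1) int[OF \<rho>]] \<rho>
    show "(\<forall>u\<in>U. 0 \<le> \<rho> u) \<and> integrable ?L \<rho> \<and> (\<integral>u. \<rho> u \<partial>?L) = 1"
      by simp
  next
    assume \<rho>: "(\<forall>u\<in>U. 0 \<le> \<rho> u) \<and> integrable ?L \<rho> \<and> (\<integral>u. \<rho> u \<partial>?L) = 1"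
    then have "\<rho> \<in> borel_measurable ?L"
      by (intro borel_measurable_integrable) simp
    with \<rho> nn show "\<rho> \<in> densities U"
      by (simp add: densities_def measurable_restrict_lborel)
  qed
qed

lemma integral_density_measure:
  fixes h :: "real^'l \<Rightarrow> real"
  assumes \<rho>: "\<rho> \<in> densities U" and h: "h \<in> borel_measurable (restrict_space borel U)"
  shows "(\<integral>u. h u \<partial>density_measure U \<rho>) = (\<integral>u. h u * \<rho> u \<partial>restrict_space lborel U)"
  unfolding density_measure_def
  using assms by (subst integral_density)
    (auto simp: densities_def measurable_restrict_lborel space_restrict_space mult.commute intro!: AE_I2)

lemma density_measure_borel_probs:
  assumes "\<rho> \<in> densities U"
  shows "density_measure U \<rho> \<in> borel_probs U"
proof -
  have [measurable]: "\<rho> \<in> borel_measurable (restrict_space lborel U)"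
    using assms by (simp add: densities_def measurable_restrict_lborel)
  have "prob_space (density_measure U \<rho>)"
    unfolding density_measure_def
    by (rule prob_spaceI)
       (use assms in \<open>simp add: emeasure_density densities_def indicator_def
          cong: nn_integral_cong\<close>)
  then show ?thesis
    by (simp add: borel_probs_def density_measure_def sets_restrict_lborel)
qed

text \<open>This realizes the identification of densities that agree almost everywhere: uniqueness
  of a density up to null sets becomes equality of controls.\<close>

lemma density_measure_cong_AE:
  assumes "\<rho> \<in> densities U" "\<rho>' \<in> densities U"
    and "AE u in restrict_space lborel U. \<rho> u = \<rho>' u"
  shows "density_measure U \<rho> = density_measure U \<rho>'"
proof -
  have [measurable]: "\<rho> \<in> borel_measurable (restrict_space lborel U)"
      "\<rho>' \<in> borel_measurable (restrict_space lborel U)"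
    using assms by (simp_all add: densities_def measurable_restrict_lborel)
  show ?thesis
    unfolding density_measure_def
    by (rule density_cong) (use assms(3) in \<open>auto elim: eventually_mono\<close>)
qed

lemma finite_measure_restrict_lborel:
  fixes U :: "(real^'l) set"
  assumes "compact U"
  shows "finite_measure (restrict_space lborel U)"
proof (rule finite_measureI)
  have "U \<in> sets lborel"
    using assms by (simp add: compact_imp_closed)
  then show "emeasure (restrict_space lborel U) (space (restrict_space lborel U)) \<noteq> \<infinity>"
    using emeasure_compact_finite[OF assms]
    by (simp add: space_restrict_space emeasure_restrict_space)
qed

lemma diff_entropy_eq_integral:
  assumes "integrable (restrict_space lborel U) (\<lambda>u. ln (\<rho> u) * \<rho> u)"
  shows "diff_entropy U \<rho> = ereal (- (\<integral>u. ln (\<rho> u) * \<rho> u \<partial>restrict_space lborel U))"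
proof -
  let ?P = "\<integral>\<^sup>+u. ennreal (ln (\<rho> u) * \<rho> u) \<partial>restrict_space lborel U"
  let ?N = "\<integral>\<^sup>+u. ennreal (- (ln (\<rho> u) * \<rho> u)) \<partial>restrict_space lborel U"
  have "?P \<noteq> \<infinity>" "?N \<noteq> \<infinity>"
    using assms by (simp_all add: real_integrable_def)
  then show ?thesis
    unfolding diff_entropy_def real_lebesgue_integral_def[OF assms]
    by (cases ?P; cases ?N) (auto simp: enn2ereal_ennreal)
qed

text \<open>By \<open>ln_mult_self_ge\<close> the negative part of
  \<open>ln (\<rho> u) * \<rho> u\<close> is at most 1, hence has finite integral on the compact set
  \<open>U\<close>. Entropy above \<open>-\<infinity>\<close> therefore forces the positive part to
  have finite integral too.\<close>

lemma integrable_entropy: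
  fixes U :: "(real^'l) set"
  assumes "compact U" and \<rho>: "\<rho> \<in> densities U" and fin: "diff_entropy U \<rho> > -\<infinity>"
  shows "integrable (restrict_space lborel U) (\<lambda>u. ln (\<rho> u) * \<rho> u)"
proof -
  let ?L = "restrict_space lborel U"
  let ?P = "\<integral>\<^sup>+u. ennreal (ln (\<rho> u) * \<rho> u) \<partial>?L"
  let ?N = "\<integral>\<^sup>+u. ennreal (- (ln (\<rho> u) * \<rho> u)) \<partial>?L"
  interpret finite_measure ?L
    by (rule finite_measure_restrict_lborel) fact
  have [measurable]: "\<rho> \<in> borel_measurable ?L"
    using \<rho> by (simp add: densities_def measurable_restrict_lborel)
  have "?N \<le> (\<integral>\<^sup>+u. 1 \<partial>?L)"
    using \<rho> by (intro nn_integral_mono) (auto simp: densities_def space_restrict_space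
      ennreal_le_1 ln_mult_self_ge)
  then have N: "?N \<noteq> \<infinity>"
    using emeasure_finite[of "space ?L"] by (auto simp: top_unique)
  have "?P \<noteq> \<infinity>"
  proof
    assume "?P = \<infinity>"
    with N have "diff_entropy U \<rho> = -\<infinity>"
      unfolding diff_entropy_def by (cases ?N) (auto simp: enn2ereal_ennreal)
    with fin show False by simp
  qed
  with N show ?thesis
    unfolding real_integrable_def by simp
qed

text \<open>The density selected by \<open>SOME\<close> may differ from \<rho>, but
  \<open>diff_entropy_unique\<close> makes the entropy independent of the selection.\<close>

lemma entropy_of_density_measure:
  assumes \<rho>: "\<rho> \<in> densities U"
    and "integrable (restrict_space lborel U) (\<lambda>u. ln (\<rho> u) * \<rho> u)"
  shows "entropy_of U (density_measure U \<rho>) =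
    - (\<integral>u. ln (\<rho> u) * \<rho> u \<partial>restrict_space lborel U)"
proof -
  let ?\<rho> = "density_of U (density_measure U \<rho>)"
  have "?\<rho> \<in> densities U \<and> density_measure U \<rho> = density_measure U ?\<rho>"
    unfolding density_of_def by (rule someI[of _ \<rho>]) (use \<rho> in simp)
  then have "diff_entropy U ?\<rho> = diff_entropy U \<rho>"
    using \<rho> by (intro diff_entropy_unique) auto
  then show ?thesis
    by (simp add: entropy_of_def diff_entropy_eq_integral[OF assms(2)])
qed

lemma regular_control_density:
  fixes U :: "(real^'l) set"
  assumes "compact U" and "\<pi> \<in> regular_controls U"
  obtains \<rho> where "\<rho> \<in> densities U" "\<pi> i = density_measure U \<rho>"
    "integrable (restrict_space lborel U) (\<lambda>u. ln (\<rho> u) * \<rho> u)"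
proof -
  obtain \<rho> where "\<rho> \<in> densities U" "\<pi> i = density_measure U \<rho>" "diff_entropy U \<rho> > -\<infinity>"
    using assms(2) unfolding regular_controls_def by blast
  with that show ?thesis
    using integrable_entropy[OF assms(1)] by blast
qed

section \<open>Equilibria\<close>

locale regularized_control =
  fixes U :: "(real^'l::finite) set"
    and p :: "real^'l \<Rightarrow> real^'d::finite^'d"
    and f :: "real \<Rightarrow> 'd \<Rightarrow> real^'l \<Rightarrow> real"
    and \<delta> :: "real \<Rightarrow> real"
    and lam :: real
  assumes compact_U: "compact U" and pos_U: "emeasure lborel U > 0"
    and stochastic: "\<And>u. u \<in> U \<Longrightarrow> stochastic_matrix (p u)"
    and p_measurable: "\<And>i. (\<lambda>u. p u $ i) \<in> borel_measurable (restrict_space borel U)"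
    and f_measurable: "\<And>t i. 0 \<le> t \<Longrightarrow> (\<lambda>u. f t i u) \<in> borel_measurable (restrict_space borel U)"
    and discount: "\<And>t. 0 \<le> t \<Longrightarrow> 0 \<le> \<delta> t \<and> \<delta> t \<le> 1" and discount_0: "\<delta> 0 = 1"
    and bounded: "(\<Sum>t. (SUP (i, u)\<in>UNIV \<times> U. ennreal \<bar>f (real t) i u\<bar>) + ennreal (\<delta> (real t))) < \<infinity>"
    and lam_pos: "lam > 0"
begin

abbreviation "L \<equiv> restrict_space lborel U"

text \<open>Makes the variational lemmas of \<open>finite_measure\<close> available for Lebesgue
  measure on \<open>U\<close>.\<close>

sublocale finite_measure L
  by (rule finite_measure_restrict_lborel[OF compact_U])

lemma space_L: "space L = U"
  by (simp add: space_restrict_space)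

text \<open>The supremum is finite by \<open>bounded\<close>, so the value 0 that
  \<open>enn2real\<close> assigns to infinity never arises.\<close>

definition reward_bound :: "nat \<Rightarrow> real" where
  "reward_bound t = enn2real (SUP (i, u)\<in>UNIV \<times> U. ennreal \<bar>f (real t) i u\<bar>)"

text \<open>A finite series in \<open>ennreal\<close> has finite terms, so the suprema can be
  replaced by real numbers. The combined real series is summable and dominates each of its two
  nonnegative parts.\<close>

lemma
  shows abs_reward_le: "u \<in> U \<Longrightarrow> \<bar>f (real t) i u\<bar> \<le> reward_bound t"
    and summable_reward_bound: "summable reward_bound"
    and summable_discount: "summable (\<lambda>t. \<delta> (real t))"
proof -
  let ?S = "\<lambda>t. SUP (i, u)\<in>UNIV \<times> U. ennreal \<bar>f (real t) i u\<bar>"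
  have fin: "?S t < \<infinity>" for t
    using ennreal_suminf_lessD[OF bounded, of t] by (simp add: less_top[symmetric])
  have S: "?S t = ennreal (reward_bound t)" for t
    using fin[of t] by (simp add: reward_bound_def)
  show "\<bar>f (real t) i u\<bar> \<le> reward_bound t" if "u \<in> U"
  proof -
    have "ennreal \<bar>f (real t) i u\<bar> \<le> ?S t"
      by (rule SUP_upper2[of "(i, u)"]) (use that in auto)
    then show ?thesis
      unfolding S by (simp add: reward_bound_def)
  qed
  have nonneg: "0 \<le> reward_bound t" "0 \<le> \<delta> (real t)" for t
    using discount by (auto simp: reward_bound_def)
  have "summable (\<lambda>t. reward_bound t + \<delta> (real t))"
    using bounded nonneg unfolding S
    by (intro summable_suminf_not_top) (auto simp: ennreal_plus[symmetric] simp del: ennreal_plus)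
  then show "summable reward_bound" "summable (\<lambda>t. \<delta> (real t))"
    by (rule summable_comparison_test'[where N = 0]; use nonneg in simp)+
qed

section \<open>Integrability of rewards and transition probabilities over actions\<close>

lemma integrable_bounded_action:
  fixes h :: "real^'l \<Rightarrow> real"
  assumes \<mu>: "\<mu> \<in> borel_probs U" and h: "h \<in> borel_measurable (restrict_space borel U)"
    and bound: "\<And>u. u \<in> U \<Longrightarrow> \<bar>h u\<bar> \<le> B"
  shows "integrable \<mu> h"
proof -
  interpret \<mu>: prob_space \<mu> using \<mu> by (simp add: borel_probs_def)
  have "sets \<mu> = sets (restrict_space borel U)"
    using \<mu> by (simp add: borel_probs_def)
  from h have "h \<in> borel_measurable \<mu>"
    unfolding measurable_cong_sets[OF \<open>sets \<mu> = _\<close> refl] .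
  then show ?thesis
    by (intro \<mu>.integrable_const_bound[where B = B] AE_I2)
      (simp_all add: space_borel_probs[OF \<mu>] bound)
qed

lemma integrable_reward:
  assumes "\<mu> \<in> borel_probs U"
  shows "integrable \<mu> (f (real t) i)"
  by (rule integrable_bounded_action[OF assms f_measurable abs_reward_le]) simp_all

lemma abs_mean_reward_le:
  assumes \<mu>: "\<mu> \<in> borel_probs U"
  shows "\<bar>mean_reward f \<mu> (real t) i\<bar> \<le> reward_bound t"
proof -
  interpret \<mu>: prob_space \<mu> using \<mu> by (simp add: borel_probs_def)
  have "\<bar>mean_reward f \<mu> (real t) i\<bar> \<le> (\<integral>u. \<bar>f (real t) i u\<bar> \<partial>\<mu>)"
    unfolding mean_reward_def by (rule integral_abs_bound)
  also have "\<dots> \<le> (\<integral>u. reward_bound t \<partial>\<mu>)"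
    using integrable_reward[OF \<mu>]
    by (intro integral_mono) (auto simp: space_borel_probs[OF \<mu>] abs_reward_le)
  finally show ?thesis
    by (simp add: \<mu>.prob_space)
qed

lemma p_component_measurable:
  "(\<lambda>u. p u $ i $ j) \<in> borel_measurable (restrict_space borel U)"
proof -
  have "(\<lambda>v::real^'d. v $ j) \<in> borel_measurable borel"
    by (rule borel_measurable_continuous_onI) (rule linear_continuous_on[OF bounded_linear_vec_nth])
  from measurable_compose[OF p_measurable this] show ?thesis .
qed

lemma p_component_bounds:
  assumes "u \<in> U"
  shows "0 \<le> p u $ i $ j" "p u $ i $ j \<le> 1"
proof -
  have nn: "0 \<le> p u $ i $ j" for j
    using stochastic[OF assms] by (simp add: stochastic_matrix_def)
  show "0 \<le> p u $ i $ j" by (rule nn)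
  have "(\<Sum>j\<in>UNIV. p u $ i $ j) = 1"
    using stochastic[OF assms] by (simp add: stochastic_matrix_def)
  then show "p u $ i $ j \<le> 1"
    using member_le_sum[of j UNIV "\<lambda>j. p u $ i $ j"] nn by simp
qed

text \<open>Up to the factor \<open>1 / lam\<close>, the value of action \<open>u\<close> in state
  \<open>i\<close> at time 0 when \<open>y\<close> is the vector of continuation values.\<close>

definition gibbs_exponent :: "real^'d \<Rightarrow> 'd \<Rightarrow> real^'l \<Rightarrow> real" where
  "gibbs_exponent y i u = 1 / lam * (f 0 i u + p u $ i \<bullet> y)"

lemma gibbs_exponent_measurable:
  "gibbs_exponent y i \<in> borel_measurable (restrict_space borel U)"
proof -
  have [measurable]: "(\<lambda>u. f 0 i u) \<in> borel_measurable (restrict_space borel U)"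
    "(\<lambda>u. p u $ i) \<in> borel_measurable (restrict_space borel U)"
    by (rule f_measurable, simp) (rule p_measurable)
  have "(\<lambda>u. 1 / lam * (f 0 i u + p u $ i \<bullet> y)) \<in> borel_measurable (restrict_space borel U)"
    by measurable
  then show ?thesis
    unfolding gibbs_exponent_def[abs_def] .
qed

lemma inner_p_eq: "p u $ i \<bullet> y = (\<Sum>j\<in>UNIV. p u $ i $ j * y $ j)"
  by (simp add: inner_vec_def)

text \<open>Entries of a stochastic matrix lie between 0 and 1, so the inner product is at most the
  sum of the absolute values of the entries of \<open>y\<close>, uniformly in the action.\<close>

lemma gibbs_exponent_bounded:
  obtains C where "\<And>u. u \<in> U \<Longrightarrow> \<bar>gibbs_exponent y i u\<bar> \<le> C"
proof
  fix u assume u: "u \<in> U"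
  have "\<bar>p u $ i \<bullet> y\<bar> \<le> (\<Sum>j\<in>UNIV. \<bar>p u $ i $ j * y $ j\<bar>)"
    unfolding inner_p_eq by (rule sum_abs)
  also have "\<dots> \<le> (\<Sum>j\<in>UNIV. \<bar>y $ j\<bar>)"
    using p_component_bounds[OF u] by (intro sum_mono) (simp add: abs_mult mult_left_le_one_le)
  finally have "\<bar>f 0 i u + p u $ i \<bullet> y\<bar> \<le> reward_bound 0 + (\<Sum>j\<in>UNIV. \<bar>y $ j\<bar>)"
    using abs_reward_le[OF u, of 0 i] by simp
  then show "\<bar>gibbs_exponent y i u\<bar> \<le> 1 / lam * (reward_bound 0 + (\<Sum>j\<in>UNIV. \<bar>y $ j\<bar>))"
    using lam_pos by (simp add: gibbs_exponent_def abs_mult divide_right_mono)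
qed

section \<open>Value of a deviation at time 0\<close>

lemma J_value_first_step:
  assumes \<pi>': "\<pi>' \<in> relaxed_controls U" and \<pi>: "\<pi> \<in> relaxed_controls U"
  shows "J_value U p f \<delta> lam (concat1 \<pi>' \<pi>) i =
    mean_reward f (\<pi>' i) 0 i + lam * entropy_of U (\<pi>' i) +
    (\<Sum>j\<in>UNIV. pmf (next_state p (\<pi>' i) i) j * V_value U p f \<delta> lam \<pi> $ j)"
proof -
  let ?\<sigma> = "concat1 \<pi>' \<pi>"
  let ?r = "\<lambda>k j. mean_reward f (?\<sigma> k j) (0 + real k) j + lam * \<delta> (0 + real k) * entropy_of U (?\<sigma> k j)"
  \<comment> \<open>Two controls on a finite state space have only finitely many entropies, so one
    constant bounds them at all times; the discount then makes the entropy terms summable.\<close>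
  define E where "E = (\<Sum>j\<in>UNIV. \<bar>entropy_of U (\<pi>' j)\<bar>) + (\<Sum>j\<in>UNIV. \<bar>entropy_of U (\<pi> j)\<bar>)"
  have ent: "\<bar>entropy_of U (?\<sigma> k j)\<bar> \<le> E" for k j
  proof -
    have "\<bar>entropy_of U (\<rho> j)\<bar> \<le> (\<Sum>j\<in>UNIV. \<bar>entropy_of U (\<rho> j)\<bar>)" for \<rho> :: "'d \<Rightarrow> (real^'l) measure"
      by (rule member_le_sum) auto
    moreover have "0 \<le> (\<Sum>j\<in>UNIV. \<bar>entropy_of U (\<rho> j)\<bar>)" for \<rho> :: "'d \<Rightarrow> (real^'l) measure"
      by (rule sum_nonneg) simp
    ultimately show ?thesis
      by (simp add: E_def concat1_def add_increasing add_increasing2)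
  qed
  have probs: "?\<sigma> k j \<in> borel_probs U" for k j
    using \<pi> \<pi>' by (simp add: concat1_def relaxed_controls_def)
  have bound: "\<bar>?r k j\<bar> \<le> reward_bound k + lam * \<delta> (real k) * E" for k j
  proof -
    have "\<bar>lam * \<delta> (real k) * entropy_of U (?\<sigma> k j)\<bar> \<le> lam * \<delta> (real k) * E"
      using ent[of k j] lam_pos discount[of "real k"] by (simp add: abs_mult mult_left_mono)
    with abs_mean_reward_le[OF probs, of k j k j] show ?thesis
      by simp
  qed
  have sm: "summable (\<lambda>k. reward_bound k + lam * \<delta> (real k) * E)"
    by (intro summable_add summable_mult2 summable_mult summable_reward_bound summable_discount)
  \<comment> \<open>From time 1 on the concatenated control is constantly \<pi>, and the clock of
    reward and discount is ahead by one: this is exactly the shift 1 in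
    \<open>V_value\<close>.\<close>
  have tail: "(\<integral>\<omega>. (\<Sum>k. ?r (Suc k) (\<omega> k)) \<partial>chain_law p (\<lambda>k. ?\<sigma> (Suc k)) j) =
      V_value U p f \<delta> lam \<pi> $ j" for j
    by (simp add: V_value_def shifted_value_def concat1_def)
  show ?thesis
    unfolding J_value_def shifted_value_def
    using chain_first_step[where r = ?r and p = p and \<sigma> = ?\<sigma> and i = i, OF bound sm]
    unfolding tail by (simp add: concat1_def discount_0)
qed

text \<open>Transition probabilities are averages of matrix entries over actions, so immediate
  reward and expected continuation merge into one integral of \<open>lam * gibbs_exponent\<close>.
  The result is \<open>lam\<close> times the functional bounded by the variational
  principle.\<close>

lemma J_value_concat1_eq:
  assumes \<pi>': "\<pi>' \<in> relaxed_controls U" and \<pi>: "\<pi> \<in> relaxed_controls U"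
    and \<rho>: "\<rho> \<in> densities U" "\<pi>' i = density_measure U \<rho>"
      "integrable L (\<lambda>u. ln (\<rho> u) * \<rho> u)"
  shows "J_value U p f \<delta> lam (concat1 \<pi>' \<pi>) i =
    lam * ((\<integral>u. gibbs_exponent (V_value U p f \<delta> lam \<pi>) i u * \<rho> u \<partial>L) - (\<integral>u. ln (\<rho> u) * \<rho> u \<partial>L))"
proof -
  let ?y = "V_value U p f \<delta> lam \<pi>"
  let ?\<mu> = "\<pi>' i"
  have \<mu>: "?\<mu> \<in> borel_probs U"
    using \<pi>' by (simp add: relaxed_controls_def)
  have next_state: "pmf (next_state p ?\<mu> i) j = (\<integral>u. p u $ i $ j \<partial>?\<mu>)" for j
    by (rule pmf_next_state[OF stochastic p_measurable \<mu>])
  have int_p: "integrable ?\<mu> (\<lambda>u. p u $ i $ j)" for j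
    by (rule integrable_bounded_action[OF \<mu> p_component_measurable, of _ _ 1])
      (simp add: p_component_bounds)
  have int_f: "integrable ?\<mu> (f 0 i)"
    using integrable_reward[OF \<mu>, of 0] by simp
  have "mean_reward f ?\<mu> 0 i + (\<Sum>j\<in>UNIV. pmf (next_state p ?\<mu> i) j * ?y $ j) =
      (\<integral>u. f 0 i u + (\<Sum>j\<in>UNIV. p u $ i $ j * ?y $ j) \<partial>?\<mu>)"
    using int_f int_p by (simp add: mean_reward_def next_state)
  also have "\<dots> = (\<integral>u. lam * gibbs_exponent ?y i u \<partial>?\<mu>)"
    using lam_pos by (simp add: gibbs_exponent_def inner_p_eq)
  also have "\<dots> = lam * (\<integral>u. gibbs_exponent ?y i u * \<rho> u \<partial>L)"
    by (simp add: \<rho>(2) integral_density_measure[OF \<rho>(1) gibbs_exponent_measurable])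
  finally show ?thesis
    unfolding J_value_first_step[OF \<pi>' \<pi>]
    using entropy_of_density_measure[OF \<rho>(1,3)] by (simp add: \<rho>(2) algebra_simps)
qed

section \<open>The partition function and the Gibbs density\<close>

definition partition_function :: "real^'d \<Rightarrow> 'd \<Rightarrow> real" where
  "partition_function y i = (\<integral>u. exp (gibbs_exponent y i u) \<partial>L)"

lemma integrable_L_bounded:
  fixes h :: "real^'l \<Rightarrow> real"
  assumes "h \<in> borel_measurable (restrict_space borel U)" "\<And>u. u \<in> U \<Longrightarrow> \<bar>h u\<bar> \<le> B"
  shows "integrable L h"
  using assms by (intro integrable_const_bound[of _ B] AE_I2) (auto simp: space_L measurable_restrict_lborel)

lemma integrable_exp_gibbs_exponent: "integrable L (\<lambda>u. exp (gibbs_exponent y i u))"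
proof -
  obtain C where C: "\<And>u. u \<in> U \<Longrightarrow> \<bar>gibbs_exponent y i u\<bar> \<le> C"
    using gibbs_exponent_bounded[where y = y and i = i] by blast
  note [measurable] = gibbs_exponent_measurable
  show ?thesis
    by (rule integrable_L_bounded[of _ "exp C"]) (measurable, use C in \<open>fastforce simp: abs_le_iff\<close>)
qed

text \<open>A zero integral of the strictly positive exponential would make \<open>U\<close> a null
  set, contrary to \<open>pos_U\<close>.\<close>

lemma partition_function_pos: "partition_function y i > 0"
proof -
  have "0 \<le> partition_function y i"
    unfolding partition_function_def by (rule Bochner_Integration.integral_nonneg) simp
  moreover have "partition_function y i \<noteq> 0"
  proof
    assume "partition_function y i = 0"
    then have "AE u in L. exp (gibbs_exponent y i u) = 0"
      unfolding partition_function_def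
      by (subst (asm) integral_nonneg_eq_0_iff_AE[OF integrable_exp_gibbs_exponent]) auto
    then have "emeasure L (space L) = 0"
      by (simp add: AE_iff_null null_sets_def)
    moreover have "U \<in> sets lborel"
      using compact_U by (simp add: compact_imp_closed)
    ultimately show False
      using pos_U by (simp add: space_L emeasure_restrict_space)
  qed
  ultimately show ?thesis by simp
qed

lemma gibbs_density_eq:
  "gibbs_density U p f lam y i u = exp (gibbs_exponent y i u) / partition_function y i"
  by (simp add: gibbs_density_def gibbs_exponent_def partition_function_def)

lemma ln_gibbs_density:
  "ln (gibbs_density U p f lam y i u) = gibbs_exponent y i u - ln (partition_function y i)"
  using partition_function_pos[of y i] by (simp add: gibbs_density_eq ln_div)

lemma gibbs_density_densities: "gibbs_density U p f lam y i \<in> densities U"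
  using partition_function_pos[of y i] integrable_exp_gibbs_exponent[of y i]
  by (simp add: densities_iff gibbs_density_eq[abs_def] partition_function_def[symmetric])

lemma integrable_gibbs_exponent_mult:
  assumes "\<rho> \<in> densities U"
  shows "integrable L (\<lambda>u. gibbs_exponent y i u * \<rho> u)"
proof -
  obtain C where C: "\<And>u. u \<in> U \<Longrightarrow> \<bar>gibbs_exponent y i u\<bar> \<le> C"
    using gibbs_exponent_bounded[where y = y and i = i] by blast
  have \<rho>: "integrable L \<rho>" "\<And>u. u \<in> U \<Longrightarrow> 0 \<le> \<rho> u"
    using assms by (auto simp: densities_iff)
  show ?thesis
  proof (rule Bochner_Integration.integrable_bound)
    show "integrable L (\<lambda>u. C * \<rho> u)"
      using \<rho>(1) by simp
    show "(\<lambda>u. gibbs_exponent y i u * \<rho> u) \<in> borel_measurable L"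
      using \<rho>(1) gibbs_exponent_measurable by (auto simp: measurable_restrict_lborel)
    have "\<bar>gibbs_exponent y i u * \<rho> u\<bar> \<le> \<bar>C * \<rho> u\<bar>" if "u \<in> U" for u
      using C[OF that] \<rho>(2)[OF that] by (auto simp: abs_mult intro!: mult_right_mono)
    then show "AE u in L. norm (gibbs_exponent y i u * \<rho> u) \<le> norm (C * \<rho> u)"
      by (intro AE_I2) (simp add: space_L)
  qed
qed

lemma integrable_gibbs_entropy:
  "integrable L (\<lambda>u. ln (gibbs_density U p f lam y i u) * gibbs_density U p f lam y i u)"
  using integrable_gibbs_exponent_mult[OF gibbs_density_densities, of y i y i]
    gibbs_density_densities[of y i]
  by (simp add: ln_gibbs_density left_diff_distrib densities_iff)

text \<open>The equality case of the variational bound: by \<open>ln_gibbs_density\<close> the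
  exponent terms cancel, leaving \<open>ln (partition_function y i)\<close> times the total mass
  1.\<close>

lemma gibbs_density_value:
  "(\<integral>u. gibbs_exponent y i u * gibbs_density U p f lam y i u \<partial>L) -
    (\<integral>u. ln (gibbs_density U p f lam y i u) * gibbs_density U p f lam y i u \<partial>L) =
    ln (partition_function y i)"
  using integrable_gibbs_exponent_mult[OF gibbs_density_densities, of y i y i]
    gibbs_density_densities[of y i]
  by (simp add: ln_gibbs_density left_diff_distrib densities_iff)

lemma gibbs_control_regular: "gibbs_control U p f lam y \<in> regular_controls U"
proof -
  have "diff_entropy U (gibbs_density U p f lam y i) > -\<infinity>" for i
    by (simp add: diff_entropy_eq_integral[OF integrable_gibbs_entropy])
  then show ?thesis
    using gibbs_density_densities[of y] density_measure_borel_probs[OF gibbs_density_densities, of y]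
    unfolding regular_controls_def relaxed_controls_def gibbs_control_def by blast
qed

text \<open>The variational principle is applied at state \<open>i\<close> with
  \<open>gibbs_exponent y i\<close> and a density of \<open>\<pi>' i\<close>. Hence
  \<open>lam * ln (partition_function y i)\<close> is the best value of a deviation from \<pi>, and
  the Gibbs measure is the only choice at \<open>i\<close> that attains it.\<close>

lemma
  assumes \<pi>': "\<pi>' \<in> regular_controls U" and \<pi>: "\<pi> \<in> regular_controls U"
  defines "y \<equiv> V_value U p f \<delta> lam \<pi>"
  shows J_value_concat1_le: "J_value U p f \<delta> lam (concat1 \<pi>' \<pi>) i \<le> lam * ln (partition_function y i)"
    and J_value_concat1_eqD: "J_value U p f \<delta> lam (concat1 \<pi>' \<pi>) i = lam * ln (partition_function y i) \<Longrightarrow>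
      \<pi>' i = gibbs_control U p f lam y i"
    and J_value_concat1_gibbs:
      "J_value U p f \<delta> lam (concat1 (gibbs_control U p f lam y) \<pi>) i = lam * ln (partition_function y i)"
proof -
  have relaxed: "\<pi>' \<in> relaxed_controls U" "\<pi> \<in> relaxed_controls U"
      "gibbs_control U p f lam y \<in> relaxed_controls U"
    using \<pi> \<pi>' gibbs_control_regular by (auto simp: regular_controls_def)
  obtain \<rho> where \<rho>: "\<rho> \<in> densities U" "\<pi>' i = density_measure U \<rho>"
      "integrable L (\<lambda>u. ln (\<rho> u) * \<rho> u)"
    using regular_control_density[OF compact_U \<pi>'] .
  have \<rho>': "\<forall>u\<in>space L. 0 \<le> \<rho> u" "integrable L \<rho>" "(\<integral>u. \<rho> u \<partial>L) = 1"
    using \<rho>(1) by (auto simp: densities_iff space_L)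
  have J: "J_value U p f \<delta> lam (concat1 \<pi>' \<pi>) i =
      lam * ((\<integral>u. gibbs_exponent y i u * \<rho> u \<partial>L) - (\<integral>u. ln (\<rho> u) * \<rho> u \<partial>L))"
    unfolding y_def by (rule J_value_concat1_eq[OF relaxed(1,2) \<rho>])
  note gibbs = partition_function_pos[of y i, unfolded partition_function_def]
    integrable_exp_gibbs_exponent[of y i] \<rho>' integrable_gibbs_exponent_mult[OF \<rho>(1), of y i] \<rho>(3)
  show "J_value U p f \<delta> lam (concat1 \<pi>' \<pi>) i \<le> lam * ln (partition_function y i)"
    unfolding J partition_function_def
    using gibbs_variational_le[OF gibbs] lam_pos by (intro mult_left_mono) auto
  show "\<pi>' i = gibbs_control U p f lam y i"
    if "J_value U p f \<delta> lam (concat1 \<pi>' \<pi>) i = lam * ln (partition_function y i)"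
  proof -
    have "(\<integral>u. gibbs_exponent y i u * \<rho> u \<partial>L) - (\<integral>u. ln (\<rho> u) * \<rho> u \<partial>L) = ln (partition_function y i)"
      using that lam_pos unfolding J by simp
    then have "AE u in L. \<rho> u = gibbs_density U p f lam y i u"
      unfolding gibbs_density_eq partition_function_def by (rule gibbs_variational_unique[OF gibbs])
    then show ?thesis
      unfolding \<rho>(2) gibbs_control_def by (rule density_measure_cong_AE[OF \<rho>(1) gibbs_density_densities])
  qed
  show "J_value U p f \<delta> lam (concat1 (gibbs_control U p f lam y) \<pi>) i = lam * ln (partition_function y i)"
    using J_value_concat1_eq[OF relaxed(3,2) gibbs_density_densities _ integrable_gibbs_entropy, of i y i]
    by (simp add: gibbs_control_def gibbs_density_value y_def)
qed

section \<open>Equilibria as fixed points of the Gibbs map\<close>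

lemma concat1_same: "concat1 \<pi> \<pi> = (\<lambda>_. \<pi>)"
  by (auto simp: concat1_def)

text \<open>By \<open>concat1_same\<close>, \<pi> is a deviation from itself. If it is an
  equilibrium, it does at least as well as the Gibbs deviation, so it attains the optimum in every
  state and uniqueness applies. Conversely, the Gibbs control attains the upper bound for all
  deviations.\<close>

lemma regular_equilibrium_iff_gibbs:
  "regular_equilibrium U p f \<delta> lam \<pi> \<longleftrightarrow> \<pi> = gibbs_control U p f lam (V_value U p f \<delta> lam \<pi>)"
proof
  assume eq: "regular_equilibrium U p f \<delta> lam \<pi>"
  then have reg: "\<pi> \<in> regular_controls U"
    by (simp add: regular_equilibrium_def)
  show "\<pi> = gibbs_control U p f lam (V_value U p f \<delta> lam \<pi>)"
  proof
    fix i
    have "lam * ln (partition_function (V_value U p f \<delta> lam \<pi>) i) \<le> J_value U p f \<delta> lam (concat1 \<pi> \<pi>) i"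
      using eq gibbs_control_regular
      by (simp add: regular_equilibrium_def concat1_same flip: J_value_concat1_gibbs[OF reg reg])
    then show "\<pi> i = gibbs_control U p f lam (V_value U p f \<delta> lam \<pi>) i"
      by (intro J_value_concat1_eqD[OF reg reg] antisym J_value_concat1_le[OF reg reg])
  qed
next
  assume eq: "\<pi> = gibbs_control U p f lam (V_value U p f \<delta> lam \<pi>)"
  then have reg: "\<pi> \<in> regular_controls U"
    using gibbs_control_regular by metis
  have "J_value U p f \<delta> lam (\<lambda>_. \<pi>) i = lam * ln (partition_function (V_value U p f \<delta> lam \<pi>) i)" for i
    using J_value_concat1_gibbs[OF reg reg, of i] eq by (simp add: concat1_same)
  then show "regular_equilibrium U p f \<delta> lam \<pi>"
    using reg J_value_concat1_le[OF _ reg] by (simp add: regular_equilibrium_def)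
qed

end

theorem corollary2p1:
  fixes U :: "(real^'l::finite) set"
    and p :: "real^'l \<Rightarrow> real^'d::finite^'d"
    and f :: "real \<Rightarrow> 'd \<Rightarrow> real^'l \<Rightarrow> real"
    and \<delta> :: "real \<Rightarrow> real"
    and lam :: real
    and y :: "real^'d"
  assumes "compact U" and "emeasure lborel U > 0"
    and "\<And>u. u \<in> U \<Longrightarrow> stochastic_matrix (p u)"
    and "\<And>i. (\<lambda>u. p u $ i) \<in> borel_measurable (restrict_space borel U)"
    and "\<And>t i. 0 \<le> t \<Longrightarrow> (\<lambda>u. f t i u) \<in> borel_measurable (restrict_space borel U)"
    and "\<And>t. 0 \<le> t \<Longrightarrow> 0 \<le> \<delta> t \<and> \<delta> t \<le> 1"
    and "antimono_on {0..} \<delta>" and "\<delta> 0 = 1"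
    and "(\<Sum>t. (SUP (i, u)\<in>UNIV \<times> U. ennreal \<bar>f (real t) i u\<bar>) + ennreal (\<delta> (real t))) < \<infinity>"
    and "lam > 0"
  shows "((\<exists>\<pi>. regular_equilibrium U p f \<delta> lam \<pi> \<and> y = V_value U p f \<delta> lam \<pi>)
           \<longleftrightarrow> Psi U p f \<delta> lam y = y)
       \<and> (Psi U p f \<delta> lam y = y \<longrightarrow>
            gibbs_control U p f lam y \<in> regular_controls U \<and>
            regular_equilibrium U p f \<delta> lam (gibbs_control U p f lam y))"
proof -
  interpret regularized_control U p f \<delta> lam
    by unfold_locales (use assms in auto)
  show ?thesis
    \<comment> \<open>An equilibrium with value \<open>y\<close> equals the Gibbs control of
      \<open>y\<close>, so its value is also \<open>Psi\<close> at \<open>y\<close>. Conversely, if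
      \<open>Psi\<close> fixes \<open>y\<close>, the Gibbs control of \<open>y\<close> has value
      \<open>y\<close> and thus solves the fixed-point equation for equilibria.\<close>
    unfolding regular_equilibrium_iff_gibbs Psi_def using gibbs_control_regular by metis
qed

end
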